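(* For every integer $k\ge1$ and every $s=0,\dots,k$ the identity $$\sum_{m=1}^{s}\sum_{m,s}C_{\alpha_1,\dots,\alpha_s}^{s,m,k}=(-1)^{s}S(k,k-s)$$ holds.
   Context: $S(k,s)$ are the (signed) Stirling numbers of the first kind: $x(x-1)\cdots(x-k+1)=\sum_{s=0}^{k}S(k,s)x^{s}$. For integers $k\ge1$, $1\le s\le k-1$, $1\le m\le s$ and nonnegative integers $\alpha_1,\dots,\alpha_s$ with $\sum_{i=1}^s\alpha_i=m$, $\sum_{i=1}^s i\alpha_i=s$, the numbers $C_{\alpha_1,\dots,\alpha_s}^{s,m,k}$ are the uniquely determined universal numbers (not depending on $u$) such that for every entire or meromorphic function $u$ on $\mathbb{C}$ the operator $A=u(z)\frac{d}{dz}$ satisfies $$A^{k}=u^k\Big(\frac{d}{dz}\Big)^k+\sum_{s=1}^{k-1}\Big(\sum_{m=1}^{s}u^{k-m}\sum_{m,s}C_{\alpha_1,\dots,\alpha_s}^{s,m,k}\Big(\frac{du}{dz}\Big)^{\alpha_1}\cdots\Big(\frac{d^su}{dz^s}\Big)^{\alpha_s}\Big)\Big(\frac{d}{dz}\Big)^{k-s},$$ where $\sum_{m,s}$ is over all nonnegative integers $\alpha_1,\dots,\alpha_s$ with $\sum_{i=1}^s\alpha_i=m$ and $\sum_{i=1}^s i\alpha_i=s$. Conventions: for $s=0$ the double sum $\sum_{m=1}^{s}\sum_{m,s}$ is understood to equal $1$ (coefficient of $u^k(d/dz)^k$), and $C_{\alpha_1,\dots,\alpha_k}^{k,m,k}=0$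 (the coefficient of $(d/dz)^0$ in $A^k$ is $0$). *)

theory Defs
  imports "HOL-Complex_Analysis.Complex_Analysis"
begin

text \<open>The signed Stirling number \<open>S(k,s)\<close> is the coefficient of \<open>x\<^sup>s\<close> in \<open>x(x-1)\<dots>(x-k+1)\<close>
  (the library function \<open>stirling\<close> gives the unsigned ones).\<close>

definition signed_stirling :: "nat \<Rightarrow> nat \<Rightarrow> int" where
  "signed_stirling k s = coeff (\<Prod>i<k. [:- int i, 1:]) s"

definition vf_op :: "(complex \<Rightarrow> complex) \<Rightarrow> (complex \<Rightarrow> complex) \<Rightarrow> (complex \<Rightarrow> complex)" where
  "vf_op u g = (\<lambda>z. u z * deriv g z)"

text \<open>A tuple \<open>(\<alpha>\<^sub>1,\<dots>,\<alpha>\<^sub>s)\<close> is a function on \<open>nat\<close> that vanishes outside \<open>{1..s}\<close>.\<close>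

definition alphas :: "nat \<Rightarrow> nat \<Rightarrow> (nat \<Rightarrow> nat) set" where
  "alphas s m = {\<alpha>. (\<forall>i. i \<notin> {1..s} \<longrightarrow> \<alpha> i = 0) \<and>
                     (\<Sum>i=1..s. \<alpha> i) = m \<and> (\<Sum>i=1..s. i * \<alpha> i) = s}"

text \<open>\<open>is_expansion k c\<close> says that \<open>c s m \<alpha>\<close> are universal coefficients for the \<open>k\<close>-th power of
  \<open>u d/dz\<close>. Entire functions are a special case of \<open>meromorphic_on UNIV\<close>. The identity is demanded
  at the points at which \<open>u\<close> and the function \<open>f\<close> acted upon are regular: a function that is
  \<open>meromorphic_on UNIV\<close> has an arbitrary value at each of its poles and removable singularities.
  Outside the range \<open>1 \<le> m \<le> s \<le> k - 1\<close>, \<open>\<alpha> \<in> alphas s m\<close> the coefficients are set to zero; this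
  makes the family unique and includes the convention for \<open>s = k\<close>.\<close>

definition is_expansion :: "nat \<Rightarrow> (nat \<Rightarrow> nat \<Rightarrow> (nat \<Rightarrow> nat) \<Rightarrow> complex) \<Rightarrow> bool" where
  "is_expansion k c \<longleftrightarrow>
     (\<forall>s m \<alpha>. \<not> (1 \<le> s \<and> s \<le> k - 1 \<and> 1 \<le> m \<and> m \<le> s \<and> \<alpha> \<in> alphas s m) \<longrightarrow> c s m \<alpha> = 0) \<and>
     (\<forall>u f z. u meromorphic_on UNIV \<longrightarrow> f meromorphic_on UNIV \<longrightarrow>
        u analytic_on {z} \<longrightarrow> f analytic_on {z} \<longrightarrow>
        (vf_op u ^^ k) f z =
          u z ^ k * (deriv ^^ k) f z +
          (\<Sum>s=1..k - 1.
             (\<Sum>m=1..s. u z ^ (k - m) *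
                (\<Sum>\<alpha>\<in>alphas s m. c s m \<alpha> * (\<Prod>i=1..s. (deriv ^^ i) u z ^ \<alpha> i))) *
             (deriv ^^ (k - s)) f z))"

text \<open>For \<open>k \<ge> 1\<close> the expansion exists and is unique, see \<open>is_expansion_ex1\<close> below.\<close>

definition expansion_coeff :: "nat \<Rightarrow> nat \<Rightarrow> nat \<Rightarrow> (nat \<Rightarrow> nat) \<Rightarrow> complex" where
  "expansion_coeff s m k = (THE c. is_expansion k c) s m"

lemma sum_weight_le: "(\<Sum>i=1..s. \<alpha> i) \<le> (\<Sum>i=1..s. i * \<alpha> i)" for \<alpha> :: "nat \<Rightarrow> nat"
  by (rule sum_mono) auto

lemma alphas_le:
  assumes "\<alpha> \<in> alphas s m"
  shows "\<alpha> i \<le> s"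
proof (cases "i \<in> {1..s}")
  case True
  have "\<alpha> i \<le> (\<Sum>i=1..s. \<alpha> i)" using True by (intro member_le_sum) auto
  also have "\<dots> \<le> (\<Sum>i=1..s. i * \<alpha> i)" by (rule sum_weight_le)
  also have "\<dots> = s" using assms by (simp add: alphas_def)
  finally show ?thesis .
qed (use assms in \<open>auto simp: alphas_def\<close>)

lemma finite_alphas: "finite (alphas s m)"
proof (rule finite_subset)
  show "alphas s m \<subseteq> {\<alpha>. \<forall>i. (i \<in> {1..s} \<longrightarrow> \<alpha> i \<in> {..s}) \<and> (i \<notin> {1..s} \<longrightarrow> \<alpha> i = 0)}"
    using alphas_le[of _ s m] by (auto simp only: alphas_def mem_Collect_eq atMost_iff)
qed (rule finite_set_of_finite_funs; simp)

subsection \<open>Uniqueness of the expansion\<close>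

lemma deriv_poly: "deriv (poly p) = poly (pderiv p)" for p :: "complex poly"
  by (intro ext DERIV_imp_deriv poly_DERIV)

lemma higher_deriv_poly: "(deriv ^^ n) (poly p) = poly ((pderiv ^^ n) p)" for p :: "complex poly"
  by (induction n) (simp_all add: deriv_poly)

lemma analytic_poly: "poly p analytic_on S" for p :: "complex poly"
proof -
  have "poly p holomorphic_on UNIV"
    by (metis holomorphic_on_open open_UNIV poly_DERIV)
  then have "poly p analytic_on UNIV"
    by (simp add: analytic_on_open)
  then show ?thesis
    using analytic_on_subset by blast
qed

lemma obtain_jet:
  fixes x :: "nat \<Rightarrow> complex"
  obtains p :: "complex poly" where "\<And>i. i \<le> n \<Longrightarrow> (deriv ^^ i) (poly p) 0 = x i"
proof
  fix i assume i: "i \<le> n"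
  define p where "p = (\<Sum>j\<le>n. monom (x j / fact j) j)"
  have "coeff p i = x i / fact i"
    using i by (simp add: p_def coeff_sum)
  then show "(deriv ^^ i) (poly (\<Sum>j\<le>n. monom (x j / fact j) j)) 0 = x i"
    by (simp add: higher_deriv_poly poly_0_coeff_0 coeff_higher_pderiv p_def flip: pochhammer_fact)
qed

lemma digits_unique:
  fixes a b :: "nat \<Rightarrow> nat"
  assumes "\<And>i. i < n \<Longrightarrow> a i < B" "\<And>i. i < n \<Longrightarrow> b i < B"
    and "(\<Sum>i<n. a i * B ^ i) = (\<Sum>i<n. b i * B ^ i)" "i < n"
  shows "a i = b i"
  using assms
proof (induction n arbitrary: a b i)
  case (Suc n)
  define A where "A = (\<Sum>i<n. a (Suc i) * B ^ i)"
  define A' where "A' = (\<Sum>i<n. b (Suc i) * B ^ i)"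
  have *: "(\<Sum>i<Suc n. c i * B ^ i) = c 0 + B * (\<Sum>i<n. c (Suc i) * B ^ i)" for c :: "nat \<Rightarrow> nat"
    by (simp add: sum.lessThan_Suc_shift sum_distrib_left mult_ac del: sum.lessThan_Suc)
  have eq: "a 0 + B * A = b 0 + B * A'"
    using Suc.prems(3) unfolding * A_def A'_def .
  have lt: "a 0 < B" "b 0 < B" using Suc.prems by auto
  have 0: "a 0 = b 0"
    using arg_cong[OF eq, of "\<lambda>x. x mod B"] lt by simp
  then have "A = A'" using eq lt by simp
  then have "a (Suc j) = b (Suc j)" if "j < n" for j
    using Suc.IH[of "\<lambda>i. a (Suc i)" "\<lambda>i. b (Suc i)" j] Suc.prems that by (auto simp: A_def A'_def)
  with 0 Suc.prems(4) show ?case by (cases i) auto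
qed simp

lemma alphas_monomials_independent:
  fixes d :: "nat \<Rightarrow> (nat \<Rightarrow> nat) \<Rightarrow> complex"
  assumes "\<And>x :: nat \<Rightarrow> complex. (\<Sum>m=1..s. \<Sum>\<alpha>\<in>alphas s m. d m \<alpha> * (\<Prod>i=1..s. x i ^ \<alpha> i)) = 0"
    and m: "m \<in> {1..s}" and \<alpha>: "\<alpha> \<in> alphas s m"
  shows "d m \<alpha> = 0"
proof -
  define h where "h = (\<lambda>p::nat \<times> (nat \<Rightarrow> nat). \<Sum>i=1..s. snd p i * Suc s ^ i)"
  define I where "I = (SIGMA m:{1..s}. alphas s m)"
  define P where "P = (\<Sum>p\<in>I. monom (d (fst p) (snd p)) (h p))"
  have fin: "finite I" by (auto simp: I_def finite_alphas)
  have inj: "inj_on h I"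
  proof (rule inj_onI)
    fix p q assume p: "p \<in> I" and q: "q \<in> I" and eq: "h p = h q"
    obtain m1 a where p': "p = (m1, a)" by force
    obtain m2 b where q': "q = (m2, b)" by force
    have a: "a \<in> alphas s m1" and b: "b \<in> alphas s m2" using p q by (auto simp: I_def p' q')
    have a0: "a 0 = 0" "b 0 = 0" using a b by (auto simp: alphas_def)
    have *: "(\<Sum>i<Suc s. c i * Suc s ^ i) = (\<Sum>i=1..s. c i * Suc s ^ i)" if "c 0 = 0" for c :: "nat \<Rightarrow> nat"
      using that by (intro sum.mono_neutral_right) (auto simp: not_less_eq_eq)
    have "(\<Sum>i<Suc s. a i * Suc s ^ i) = (\<Sum>i<Suc s. b i * Suc s ^ i)"
      using eq *[of a, OF a0(1)] *[of b, OF a0(2)] by (simp only: h_def p' q' snd_conv)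
    then have "a i = b i" if "i < Suc s" for i
      using digits_unique[of "Suc s" a "Suc s" b i] that alphas_le[OF a] alphas_le[OF b]
      by (simp only: less_Suc_eq_le)
    moreover have "a i = b i" if "\<not> i < Suc s" for i
      using a b that by (simp add: alphas_def)
    ultimately have "a = b" by blast
    moreover have "m1 = m2" using a b \<open>a = b\<close> by (simp add: alphas_def)
    ultimately show "p = q" by (simp add: p' q')
  qed
  have "poly P t = 0" for t
  proof -
    have "0 = (\<Sum>m=1..s. \<Sum>\<alpha>\<in>alphas s m. d m \<alpha> * (\<Prod>i=1..s. (t ^ (Suc s ^ i)) ^ \<alpha> i))"
      using assms(1)[of "\<lambda>i. t ^ (Suc s ^ i)"] by simp
    also have "\<dots> = (\<Sum>p\<in>I. d (fst p) (snd p) * (\<Prod>i=1..s. (t ^ (Suc s ^ i)) ^ snd p i))"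
      unfolding I_def by (subst sum.Sigma) (auto simp: finite_alphas case_prod_unfold)
    also have "\<dots> = poly P t"
      by (simp add: P_def poly_sum poly_monom h_def power_sum power_mult[symmetric] mult.commute
               del: power_Suc)
    finally show ?thesis by simp
  qed
  then have "P = 0" using poly_all_0_iff_0 by blast
  have mem: "(m, \<alpha>) \<in> I" using m \<alpha> by (auto simp: I_def)
  have "0 = coeff P (h (m, \<alpha>))" by (simp add: \<open>P = 0\<close>)
  also have "\<dots> = (\<Sum>p\<in>I. if p = (m, \<alpha>) then d (fst p) (snd p) else 0)"
    unfolding P_def coeff_sum
    by (intro sum.cong refl) (use inj mem in \<open>auto simp: inj_on_def\<close>)
  also have "\<dots> = d m \<alpha>" using fin mem by simp
  finally show ?thesis by simp
qed

lemma is_expansion_unique: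
  assumes c: "is_expansion k c" and c': "is_expansion k c'"
  shows "c = c'"
proof (intro ext)
  fix s m \<alpha>
  show "c s m \<alpha> = c' s m \<alpha>"
  proof (cases "1 \<le> s \<and> s \<le> k - 1 \<and> 1 \<le> m \<and> m \<le> s \<and> \<alpha> \<in> alphas s m")
    case False
    then show ?thesis using c c' unfolding is_expansion_def by metis
  next
    case True
    then have s: "1 \<le> s" "s \<le> k - 1" by auto
    have "c s m \<alpha> - c' s m \<alpha> = 0"
    proof (rule alphas_monomials_independent[where d = "\<lambda>m \<alpha>. c s m \<alpha> - c' s m \<alpha>"])
      fix x :: "nat \<Rightarrow> complex"
      obtain p where p: "\<And>i. i \<le> k \<Longrightarrow> (deriv ^^ i) (poly p) 0 = (x(0 := 1)) i"
        using obtain_jet by blast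
      obtain q :: "complex poly" where q: "\<And>i. i \<le> k \<Longrightarrow> (deriv ^^ i) (poly q) 0 = (if i = k - s then 1 else 0)"
        using obtain_jet[of k "\<lambda>i. if i = k - s then 1 else 0"] by metis
      have p0: "poly p 0 = 1" using p[of 0] by simp
      have mero: "poly r meromorphic_on UNIV" for r :: "complex poly"
        by (intro analytic_on_imp_meromorphic_on analytic_poly)
      have *: "(vf_op (poly p) ^^ k) (poly q) 0 =
         (\<Sum>m=1..s. \<Sum>\<alpha>\<in>alphas s m. e s m \<alpha> * (\<Prod>i=1..s. x i ^ \<alpha> i))"
        if "is_expansion k e" for e
      proof -
        have "(vf_op (poly p) ^^ k) (poly q) 0 =
          poly p 0 ^ k * (deriv ^^ k) (poly q) 0 +
          (\<Sum>s=1..k - 1.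
             (\<Sum>m=1..s. poly p 0 ^ (k - m) *
                (\<Sum>\<alpha>\<in>alphas s m. e s m \<alpha> * (\<Prod>i=1..s. (deriv ^^ i) (poly p) 0 ^ \<alpha> i))) *
             (deriv ^^ (k - s)) (poly q) 0)"
          using that mero analytic_poly unfolding is_expansion_def by blast
        also have "poly p 0 ^ k * (deriv ^^ k) (poly q) 0 = 0"
          using s q[of k] by auto
        also have "(\<Sum>s=1..k - 1.
             (\<Sum>m=1..s. poly p 0 ^ (k - m) *
                (\<Sum>\<alpha>\<in>alphas s m. e s m \<alpha> * (\<Prod>i=1..s. (deriv ^^ i) (poly p) 0 ^ \<alpha> i))) *
             (deriv ^^ (k - s)) (poly q) 0) =
           (\<Sum>r=1..k - 1. if r = s then
             (\<Sum>m=1..s. \<Sum>\<alpha>\<in>alphas s m. e s m \<alpha> * (\<Prod>i=1..s. x i ^ \<alpha> i)) else 0)"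
        proof (intro sum.cong refl, goal_cases)
          case (1 r)
          have "(\<Prod>i=1..r. (deriv ^^ i) (poly p) 0 ^ a i) = (\<Prod>i=1..r. x i ^ a i)" for a
            using 1 p by (intro prod.cong) auto
          moreover have "(deriv ^^ (k - r)) (poly q) 0 = (if r = s then 1 else 0)"
            using 1 s q[of "k - r"] by auto
          ultimately show ?case by (simp add: p0)
        qed
        finally show ?thesis using s by simp
      qed
      show "(\<Sum>m=1..s. \<Sum>\<alpha>\<in>alphas s m. (c s m \<alpha> - c' s m \<alpha>) * (\<Prod>i=1..s. x i ^ \<alpha> i)) = 0"
        using *[OF c] *[OF c'] by (simp add: left_diff_distrib sum_subtractf)
    qed (use True in auto)
    then show ?thesis by simp
  qed
qed

subsection \<open>Existence of the expansion\<close>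

text \<open>For the induction on \<open>k\<close> it is convenient to include the exponent of \<open>u\<close> itself as the
  component with index 0.\<close>

definition betas :: "nat \<Rightarrow> nat \<Rightarrow> (nat \<Rightarrow> nat) set" where
  "betas k s = {\<beta>. (\<forall>i>s. \<beta> i = 0) \<and> (\<Sum>i\<le>s. \<beta> i) = k \<and> (\<Sum>i\<le>s. i * \<beta> i) = s}"

definition dmono :: "nat \<Rightarrow> (nat \<Rightarrow> nat) \<Rightarrow> (complex \<Rightarrow> complex) \<Rightarrow> complex \<Rightarrow> complex" where
  "dmono s \<beta> u z = (\<Prod>i\<le>s. (deriv ^^ i) u z ^ \<beta> i)"

definition incr :: "nat \<Rightarrow> (nat \<Rightarrow> nat) \<Rightarrow> nat \<Rightarrow> nat" where
  "incr j \<beta> = \<beta>(j := Suc (\<beta> j))"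

definition dpoly :: "nat \<Rightarrow> nat \<Rightarrow> ((complex \<Rightarrow> complex) \<Rightarrow> complex \<Rightarrow> complex) \<Rightarrow> bool" where
  "dpoly k s F \<longleftrightarrow> (\<exists>c. \<forall>u z. u analytic_on {z} \<longrightarrow> F u z = (\<Sum>\<beta>\<in>betas k s. c \<beta> * dmono s \<beta> u z))"

lemma finite_betas: "finite (betas k s)"
proof (rule finite_subset)
  have "\<beta> i \<le> k" if "\<beta> \<in> betas k s" "i \<le> s" for \<beta> i
  proof -
    have "\<beta> i \<le> (\<Sum>i\<le>s. \<beta> i)" using that by (intro member_le_sum) auto
    with that show ?thesis by (simp add: betas_def)
  qed
  then show "betas k s \<subseteq> {\<beta>. \<forall>i. (i \<in> {..s} \<longrightarrow> \<beta> i \<in> {..k}) \<and> (i \<notin> {..s} \<longrightarrow> \<beta> i = 0)}"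
    by (auto simp: betas_def)
qed (rule finite_set_of_finite_funs; simp)

lemma sum_incr:
  assumes "j \<le> s"
  shows "(\<Sum>i\<le>s. w i * incr j \<beta> i) = (\<Sum>i\<le>s. w i * \<beta> i) + (w j :: nat)"
proof -
  have "w i * incr j \<beta> i = w i * \<beta> i + (if i = j then w j else 0)" for i
    by (simp add: incr_def)
  then show ?thesis using assms by (simp add: sum.distrib)
qed

lemma dmono_incr:
  assumes "j \<le> s"
  shows "dmono s (incr j \<beta>) u z = (deriv ^^ j) u z * dmono s \<beta> u z"
proof -
  have "(deriv ^^ i) u z ^ incr j \<beta> i = (if i = j then (deriv ^^ j) u z else 1) * (deriv ^^ i) u z ^ \<beta> i" for i
    by (simp add: incr_def)
  then show ?thesis using assms by (simp add: dmono_def prod.distrib)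
qed

lemma dmono_Suc: "(\<forall>i>s. \<beta> i = 0) \<Longrightarrow> dmono (Suc s) \<beta> u z = dmono s \<beta> u z"
  by (simp add: dmono_def)

lemma betas_incr0: "\<beta> \<in> betas k s \<Longrightarrow> incr 0 \<beta> \<in> betas (Suc k) s"
  using sum_incr[of 0 s "\<lambda>_. 1" \<beta>] sum_incr[of 0 s "\<lambda>i. i" \<beta>] by (auto simp: betas_def incr_def)

lemma betas_shift:
  assumes "incr j \<gamma> \<in> betas k s" "j \<le> s"
  shows "incr 0 (incr (Suc j) \<gamma>) \<in> betas (Suc k) (Suc s)"
proof -
  have \<gamma>: "\<forall>i>s. \<gamma> i = 0"
    using assms by (auto simp: betas_def incr_def split: if_splits)
  have "(\<Sum>i\<le>s. 1 * incr j \<gamma> i) = k" "(\<Sum>i\<le>s. i * incr j \<gamma> i) = s"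
    using assms by (auto simp: betas_def)
  then have "Suc (\<Sum>i\<le>s. \<gamma> i) = k" "(\<Sum>i\<le>s. i * \<gamma> i) + j = s"
    using sum_incr[of j s "\<lambda>_. 1" \<gamma>] sum_incr[of j s "\<lambda>i. i" \<gamma>] assms(2) by auto
  moreover have "(\<Sum>i\<le>Suc s. 1 * incr 0 (incr (Suc j) \<gamma>) i) = (\<Sum>i\<le>s. \<gamma> i) + 2"
    unfolding sum_incr[OF le0] sum_incr[OF Suc_le_mono[THEN iffD2, OF assms(2)]] using \<gamma> by simp
  moreover have "(\<Sum>i\<le>Suc s. i * incr 0 (incr (Suc j) \<gamma>) i) = (\<Sum>i\<le>s. i * \<gamma> i) + Suc j"
    unfolding sum_incr[OF le0] sum_incr[OF Suc_le_mono[THEN iffD2, OF assms(2)]] using \<gamma> by simp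
  moreover have "\<forall>i>Suc s. incr 0 (incr (Suc j) \<gamma>) i = 0"
    using assms(2) \<gamma> by (auto simp: incr_def)
  ultimately show ?thesis by (simp add: betas_def)
qed

lemma dmono_deriv:
  assumes "u analytic_on {z}"
  shows "(dmono s \<beta> u has_field_derivative
           (\<Sum>j\<le>s. of_nat (\<beta> j) * (deriv ^^ j) u z ^ (\<beta> j - 1) * (deriv ^^ Suc j) u z *
              (\<Prod>i\<in>{..s} - {j}. (deriv ^^ i) u z ^ \<beta> i))) (at z)"
proof -
  have *: "((deriv ^^ j) u has_field_derivative (deriv ^^ Suc j) u z) (at z)" for j
    using analytic_higher_deriv[OF assms, of j]
    by (metis DERIV_deriv_iff_field_differentiable analytic_on_imp_differentiable_at funpow.simps(2)
        insertI1 o_apply)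
  show ?thesis unfolding dmono_def
    by (rule has_field_derivative_prod) (auto intro!: derivative_eq_intros *)
qed

lemma dpoly_cong:
  assumes "dpoly k s F" "\<And>u z. u analytic_on {z} \<Longrightarrow> G u z = F u z"
  shows "dpoly k s G"
  using assms unfolding dpoly_def by metis

lemma dpoly_0: "dpoly k s (\<lambda>u z. 0)"
  unfolding dpoly_def by (rule exI[of _ "\<lambda>_. 0"]) auto

lemma dpoly_add:
  assumes "dpoly k s F" "dpoly k s G"
  shows "dpoly k s (\<lambda>u z. F u z + G u z)"
proof -
  obtain c d where "\<forall>u z. u analytic_on {z} \<longrightarrow> F u z = (\<Sum>\<beta>\<in>betas k s. c \<beta> * dmono s \<beta> u z)"
    "\<forall>u z. u analytic_on {z} \<longrightarrow> G u z = (\<Sum>\<beta>\<in>betas k s. d \<beta> * dmono s \<beta> u z)"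
    using assms unfolding dpoly_def by blast
  then show ?thesis unfolding dpoly_def
    by (intro exI[of _ "\<lambda>\<beta>. c \<beta> + d \<beta>"]) (simp add: distrib_right sum.distrib)
qed

lemma dpoly_cmult:
  assumes "dpoly k s F"
  shows "dpoly k s (\<lambda>u z. a * F u z)"
proof -
  obtain c where "\<forall>u z. u analytic_on {z} \<longrightarrow> F u z = (\<Sum>\<beta>\<in>betas k s. c \<beta> * dmono s \<beta> u z)"
    using assms unfolding dpoly_def by blast
  then show ?thesis unfolding dpoly_def
    by (intro exI[of _ "\<lambda>\<beta>. a * c \<beta>"]) (simp add: sum_distrib_left mult_ac)
qed

lemma dpoly_sum:
  assumes "\<And>x. x \<in> A \<Longrightarrow> dpoly k s (F x)"
  shows "dpoly k s (\<lambda>u z. \<Sum>x\<in>A. F x u z)"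
  using assms by (induction A rule: infinite_finite_induct) (auto intro!: dpoly_0 dpoly_add)

lemma dpoly_dmono:
  assumes "\<beta> \<in> betas k s"
  shows "dpoly k s (dmono s \<beta>)"
  unfolding dpoly_def
  by (rule exI[of _ "\<lambda>b. if b = \<beta> then 1 else 0"])
     (use assms in \<open>simp add: finite_betas if_distrib[of "\<lambda>x. x * _"] cong: if_cong\<close>)

lemma dpoly_mult:
  assumes "dpoly k s F"
  shows "dpoly (Suc k) s (\<lambda>u z. u z * F u z)"
proof -
  obtain c where c: "\<forall>u z. u analytic_on {z} \<longrightarrow> F u z = (\<Sum>\<beta>\<in>betas k s. c \<beta> * dmono s \<beta> u z)"
    using assms unfolding dpoly_def by blast
  have "dpoly (Suc k) s (\<lambda>u z. \<Sum>\<beta>\<in>betas k s. c \<beta> * dmono s (incr 0 \<beta>) u z)"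
    by (intro dpoly_sum dpoly_cmult dpoly_dmono betas_incr0)
  then show ?thesis
    by (rule dpoly_cong) (use c in \<open>simp add: dmono_incr sum_distrib_left mult_ac\<close>)
qed

lemma dpoly_has_deriv:
  assumes "dpoly k s F"
  obtains G where "dpoly (Suc k) (Suc s) (\<lambda>u z. u z * G u z)"
    and "\<And>u z. u analytic_on {z} \<Longrightarrow> (F u has_field_derivative G u z) (at z)"
proof -
  obtain c where c: "\<And>u z. u analytic_on {z} \<Longrightarrow> F u z = (\<Sum>\<beta>\<in>betas k s. c \<beta> * dmono s \<beta> u z)"
    using assms unfolding dpoly_def by blast
  define G where "G = (\<lambda>u z. \<Sum>\<beta>\<in>betas k s. c \<beta> * (\<Sum>j\<le>s. of_nat (\<beta> j) *
    (deriv ^^ j) u z ^ (\<beta> j - 1) * (deriv ^^ Suc j) u z * (\<Prod>i\<in>{..s} - {j}. (deriv ^^ i) u z ^ \<beta> i)))"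
  have "dpoly (Suc k) (Suc s) (\<lambda>u z. u z * (of_nat (\<beta> j) *
    (deriv ^^ j) u z ^ (\<beta> j - 1) * (deriv ^^ Suc j) u z * (\<Prod>i\<in>{..s} - {j}. (deriv ^^ i) u z ^ \<beta> i)))"
    (is "dpoly _ _ ?H") if \<beta>: "\<beta> \<in> betas k s" and j: "j \<le> s" for \<beta> j
  proof (cases "\<beta> j = 0")
    case True
    then show ?thesis by (simp add: dpoly_0)
  next
    case False
    define \<gamma> where "\<gamma> = \<beta>(j := \<beta> j - 1)"
    have \<beta>\<gamma>: "\<beta> = incr j \<gamma>" using False by (simp add: incr_def \<gamma>_def)
    have \<gamma>0: "\<forall>i>s. \<gamma> i = 0" using \<beta> j by (simp add: \<gamma>_def betas_def)
    have "dpoly (Suc k) (Suc s) (\<lambda>u z. of_nat (\<beta> j) * dmono (Suc s) (incr 0 (incr (Suc j) \<gamma>)) u z)"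
      using \<beta> j unfolding \<beta>\<gamma> by (intro dpoly_cmult dpoly_dmono betas_shift)
    then show ?thesis
    proof (rule dpoly_cong)
      fix u z assume "u analytic_on {z}"
      have "dmono s \<gamma> u z = (deriv ^^ j) u z ^ \<gamma> j * (\<Prod>i\<in>{..s} - {j}. (deriv ^^ i) u z ^ \<gamma> i)"
        using j by (simp add: dmono_def prod.remove[of "{..s}" j])
      also have "(\<Prod>i\<in>{..s} - {j}. (deriv ^^ i) u z ^ \<gamma> i) = (\<Prod>i\<in>{..s} - {j}. (deriv ^^ i) u z ^ \<beta> i)"
        by (intro prod.cong) (auto simp: \<gamma>_def)
      also have "\<gamma> j = \<beta> j - 1" by (simp add: \<gamma>_def)
      finally show "?H u z = of_nat (\<beta> j) * dmono (Suc s) (incr 0 (incr (Suc j) \<gamma>)) u z"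
        using j by (simp add: dmono_incr dmono_Suc[OF \<gamma>0] mult_ac del: funpow.simps(2))
    qed
  qed
  then have "dpoly (Suc k) (Suc s) (\<lambda>u z. u z * G u z)"
    unfolding G_def sum_distrib_left
    by (subst mult.left_commute, intro dpoly_sum dpoly_cmult) auto
  moreover have "(F u has_field_derivative G u z) (at z)" if u: "u analytic_on {z}" for u z
  proof -
    have "((\<lambda>z. \<Sum>\<beta>\<in>betas k s. c \<beta> * dmono s \<beta> u z) has_field_derivative G u z) (at z)"
      unfolding G_def using u by (intro DERIV_sum DERIV_cmult dmono_deriv)
    moreover have "\<forall>\<^sub>F w in nhds z. F u w = (\<Sum>\<beta>\<in>betas k s. c \<beta> * dmono s \<beta> u w)"
    proof -
      obtain S where "open S" "z \<in> S" "u holomorphic_on S"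
        using u by (auto simp: analytic_at)
      then have "\<forall>w\<in>S. u analytic_on {w}" using analytic_at by blast
      then show ?thesis unfolding eventually_nhds using \<open>open S\<close> \<open>z \<in> S\<close> c by blast
    qed
    ultimately show ?thesis by (subst DERIV_cong_ev[OF refl _ refl])
  qed
  ultimately show thesis using that by blast
qed

lemma ex_dpoly_expansion:
  "\<exists>F. (\<forall>s\<le>k. dpoly (Suc k) s (F s)) \<and> (\<forall>u z. F 0 u z = u z ^ Suc k) \<and>
     (\<forall>u f z. u analytic_on {z} \<longrightarrow> f analytic_on {z} \<longrightarrow>
        (vf_op u ^^ Suc k) f z = (\<Sum>s\<le>k. F s u z * (deriv ^^ (Suc k - s)) f z))"
proof (induction k)
  case 0
  have "(\<lambda>i. if i = 0 then 1 else 0) \<in> betas 1 0" by (simp add: betas_def)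
  from dpoly_dmono[OF this] have "dpoly 1 0 (\<lambda>u. u)"
    by (rule dpoly_cong) (simp add: dmono_def)
  then show ?case by (intro exI[of _ "\<lambda>s u. u"]) (simp add: vf_op_def)
next
  case (Suc k)
  then obtain F where F: "\<And>s. s \<le> k \<Longrightarrow> dpoly (Suc k) s (F s)" "\<And>u z. F 0 u z = u z ^ Suc k"
    and exp: "\<And>u f z. u analytic_on {z} \<Longrightarrow> f analytic_on {z} \<Longrightarrow>
        (vf_op u ^^ Suc k) f z = (\<Sum>s\<le>k. F s u z * (deriv ^^ (Suc k - s)) f z)"
    by blast
  have "\<forall>s\<in>{..k}. \<exists>G. dpoly (Suc (Suc k)) (Suc s) (\<lambda>u z. u z * G u z) \<and>
      (\<forall>u z. u analytic_on {z} \<longrightarrow> (F s u has_field_derivative G u z) (at z))"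
    using F(1) dpoly_has_deriv by (metis atMost_iff)
  then obtain G where G: "\<And>s. s \<le> k \<Longrightarrow> dpoly (Suc (Suc k)) (Suc s) (\<lambda>u z. u z * G s u z)"
    "\<And>s u z. s \<le> k \<Longrightarrow> u analytic_on {z} \<Longrightarrow> (F s u has_field_derivative G s u z) (at z)"
    by (metis atMost_iff)
  define H1 where "H1 = (\<lambda>s u z. if s \<le> k then u z * F s u z else 0 :: complex)"
  define H2 where "H2 = (\<lambda>s u z. case s of 0 \<Rightarrow> 0 | Suc r \<Rightarrow> u z * G r u z)"
  have H1: "dpoly (Suc (Suc k)) s (H1 s)" for s
    using dpoly_mult[OF F(1), of s] dpoly_0 by (cases "s \<le> k") (simp_all add: H1_def)
  have H2: "dpoly (Suc (Suc k)) s (H2 s)" if "s \<le> Suc k" for s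
    using that G(1) dpoly_0 by (cases s) (simp_all add: H2_def)
  show ?case
  proof (intro exI[of _ "\<lambda>s u z. H1 s u z + H2 s u z"] conjI allI impI)
    fix s assume "s \<le> Suc k"
    then show "dpoly (Suc (Suc k)) s (\<lambda>u z. H1 s u z + H2 s u z)"
      using H1 H2 dpoly_add by blast
  next
    fix u z show "H1 0 u z + H2 0 u z = u z ^ Suc (Suc k)"
      by (simp add: H1_def H2_def F)
  next
    fix u f z assume u: "u analytic_on {z}" and f: "f analytic_on {z}"
    have f': "((deriv ^^ j) f has_field_derivative (deriv ^^ Suc j) f z) (at z)" for j
      using analytic_higher_deriv[OF f, of j]
      by (metis DERIV_deriv_iff_field_differentiable analytic_on_imp_differentiable_at funpow.simps(2)
          insertI1 o_apply)
    have "((\<lambda>w. \<Sum>s\<le>k. F s u w * (deriv ^^ (Suc k - s)) f w) has_field_derivative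
        (\<Sum>s\<le>k. G s u z * (deriv ^^ (Suc k - s)) f z + (deriv ^^ Suc (Suc k - s)) f z * F s u z)) (at z)"
      using u by (intro DERIV_sum DERIV_mult f' G(2)) auto
    moreover have "\<forall>\<^sub>F w in nhds z. (vf_op u ^^ Suc k) f w = (\<Sum>s\<le>k. F s u w * (deriv ^^ (Suc k - s)) f w)"
    proof -
      obtain S where "open S" "z \<in> S" "u holomorphic_on S"
        using u by (auto simp: analytic_at)
      moreover obtain T where "open T" "z \<in> T" "f holomorphic_on T"
        using f by (auto simp: analytic_at)
      ultimately have "open (S \<inter> T)" "z \<in> S \<inter> T" "\<forall>w\<in>S \<inter> T. u analytic_on {w} \<and> f analytic_on {w}"
        using analytic_at by blast+
      then show ?thesis unfolding eventually_nhds using exp by blast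
    qed
    ultimately have "((vf_op u ^^ Suc k) f has_field_derivative
        (\<Sum>s\<le>k. G s u z * (deriv ^^ (Suc k - s)) f z + (deriv ^^ Suc (Suc k - s)) f z * F s u z)) (at z)"
      by (subst DERIV_cong_ev[OF refl _ refl])
    then have "(vf_op u ^^ Suc (Suc k)) f z =
       u z * (\<Sum>s\<le>k. G s u z * (deriv ^^ (Suc k - s)) f z + (deriv ^^ Suc (Suc k - s)) f z * F s u z)"
      by (subst funpow.simps(2)) (simp add: vf_op_def[of u "(vf_op u ^^ Suc k) f"] DERIV_imp_deriv del: funpow.simps)
    also have "\<dots> = (\<Sum>s\<le>k. H1 s u z * (deriv ^^ (Suc (Suc k) - s)) f z) +
                     (\<Sum>s\<le>k. H2 (Suc s) u z * (deriv ^^ (Suc (Suc k) - Suc s)) f z)"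
      unfolding sum.distrib[symmetric] sum_distrib_left
      by (intro sum.cong refl) (simp add: H1_def H2_def Suc_diff_le algebra_simps del: funpow.simps)
    also have "(\<Sum>s\<le>k. H1 s u z * (deriv ^^ (Suc (Suc k) - s)) f z) =
               (\<Sum>s\<le>Suc k. H1 s u z * (deriv ^^ (Suc (Suc k) - s)) f z)"
      by (simp add: H1_def del: funpow.simps)
    also have "(\<Sum>s\<le>k. H2 (Suc s) u z * (deriv ^^ (Suc (Suc k) - Suc s)) f z) =
               (\<Sum>s\<le>Suc k. H2 s u z * (deriv ^^ (Suc (Suc k) - s)) f z)"
      by (subst sum.atMost_Suc_shift) (simp add: H2_def del: funpow.simps)
    finally show "(vf_op u ^^ Suc (Suc k)) f z =
        (\<Sum>s\<le>Suc k. (H1 s u z + H2 s u z) * (deriv ^^ (Suc (Suc k) - s)) f z)"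
      by (simp only: distrib_right sum.distrib)
  qed
qed

lemma sum_betas:
  fixes g :: "(nat \<Rightarrow> nat) \<Rightarrow> complex"
  assumes s: "1 \<le> s" "s \<le> k"
  shows "(\<Sum>\<beta>\<in>betas k s. g \<beta>) = (\<Sum>m=1..s. \<Sum>\<alpha>\<in>alphas s m. g (\<alpha>(0 := k - m)))"
proof -
  have split: "(\<Sum>i\<le>s. h i) = h 0 + (\<Sum>i=1..s. h i)" for h :: "nat \<Rightarrow> nat"
  proof -
    have "{..s} = insert 0 {1..s}" by auto
    then show ?thesis by simp
  qed
  have upd: "(\<Sum>i=1..s. h i * (b(0 := x)) i) = (\<Sum>i=1..s. h i * b i)" for h b :: "nat \<Rightarrow> nat" and x
    by (intro sum.cong) auto
  have upd1: "(\<Sum>i=1..s. (b(0 := x)) i) = (\<Sum>i=1..s. b i)" for b :: "nat \<Rightarrow> nat" and x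
    by (intro sum.cong) auto
  have "(\<Sum>m=1..s. \<Sum>\<alpha>\<in>alphas s m. g (\<alpha>(0 := k - m))) =
      (\<Sum>(m,\<alpha>)\<in>(SIGMA m:{1..s}. alphas s m). g (\<alpha>(0 := k - m)))"
    by (subst sum.Sigma) (auto simp: finite_alphas)
  also have "\<dots> = (\<Sum>\<beta>\<in>betas k s. g \<beta>)"
  proof (rule sum.reindex_bij_witness[where i = "\<lambda>\<beta>. (\<Sum>i=1..s. \<beta> i, \<beta>(0 := 0))"
        and j = "\<lambda>(m, \<alpha>). \<alpha>(0 := k - m)"])
    fix p assume "p \<in> (SIGMA m:{1..s}. alphas s m)"
    then obtain m \<alpha> where p: "p = (m, \<alpha>)" "1 \<le> m" "m \<le> s" "\<alpha> \<in> alphas s m" by auto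
    then have a: "\<forall>i. i \<notin> {1..s} \<longrightarrow> \<alpha> i = 0" "(\<Sum>i=1..s. \<alpha> i) = m" "(\<Sum>i=1..s. i * \<alpha> i) = s"
      by (auto simp: alphas_def)
    show "(case p of (m, \<alpha>) \<Rightarrow> \<alpha>(0 := k - m)) \<in> betas k s"
      using a p s unfolding p(1) prod.case betas_def mem_Collect_eq split upd upd1 by simp
    show "(\<Sum>i=1..s. (case p of (m, \<alpha>) \<Rightarrow> \<alpha>(0 := k - m)) i,
           (case p of (m, \<alpha>) \<Rightarrow> \<alpha>(0 := k - m))(0 := 0)) = p"
      using a unfolding p(1) prod.case upd1 by (auto simp: fun_eq_iff)
    show "g (case p of (m, \<alpha>) \<Rightarrow> \<alpha>(0 := k - m)) = (case p of (m, \<alpha>) \<Rightarrow> g (\<alpha>(0 := k - m)))"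
      by (simp add: p)
  next
    fix \<beta> assume "\<beta> \<in> betas k s"
    then have b: "\<forall>i>s. \<beta> i = 0" "\<beta> 0 + (\<Sum>i=1..s. \<beta> i) = k" "(\<Sum>i=1..s. i * \<beta> i) = s"
      by (auto simp: betas_def split)
    then have b0: "k - (\<Sum>i=1..s. \<beta> i) = \<beta> 0" by linarith
    show "(case (\<Sum>i=1..s. \<beta> i, \<beta>(0 := 0)) of (m, \<alpha>) \<Rightarrow> \<alpha>(0 := k - m)) = \<beta>"
      unfolding prod.case b0 by (simp add: fun_eq_iff)
    have "(\<Sum>i=1..s. \<beta> i) \<noteq> 0"
    proof
      assume "(\<Sum>i=1..s. \<beta> i) = 0"
      then have "\<forall>i\<in>{1..s}. \<beta> i = 0" by simp
      then have "(\<Sum>i=1..s. i * \<beta> i) = 0" by simp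
      with b(3) s show False by linarith
    qed
    moreover have "(\<Sum>i=1..s. \<beta> i) \<le> s" using sum_weight_le[of \<beta> s] b(3) by linarith
    ultimately have "(\<Sum>i=1..s. \<beta> i) \<in> {1..s}" unfolding atLeastAtMost_iff by linarith
    moreover have "\<beta>(0 := 0) \<in> alphas s (\<Sum>i=1..s. \<beta> i)"
      unfolding alphas_def mem_Collect_eq upd upd1
    proof (intro conjI)
      show "\<forall>i. i \<notin> {1..s} \<longrightarrow> (\<beta>(0 := 0)) i = 0"
        using b(1) by (metis atLeastAtMost_iff fun_upd_apply less_one not_le)
    qed (use b(3) in simp_all)
    ultimately show "(\<Sum>i=1..s. \<beta> i, \<beta>(0 := 0)) \<in> (SIGMA m:{1..s}. alphas s m)"
      by blast
  qed
  finally show ?thesis by simp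
qed

lemma is_expansion_exists:
  assumes "k \<ge> 1"
  shows "\<exists>c. is_expansion k c"
proof -
  obtain n where k: "k = Suc n" using assms by (cases k) auto
  obtain F where F: "\<And>s. s \<le> n \<Longrightarrow> dpoly k s (F s)" "\<And>u z. F 0 u z = u z ^ k"
    and exp: "\<And>u f z. u analytic_on {z} \<Longrightarrow> f analytic_on {z} \<Longrightarrow>
        (vf_op u ^^ k) f z = (\<Sum>s\<le>n. F s u z * (deriv ^^ (k - s)) f z)"
    using ex_dpoly_expansion[of n] unfolding k by blast
  have "\<forall>s\<in>{..n}. \<exists>c. \<forall>u z. u analytic_on {z} \<longrightarrow> F s u z = (\<Sum>\<beta>\<in>betas k s. c \<beta> * dmono s \<beta> u z)"
    using F(1) unfolding dpoly_def by auto
  then obtain C where C: "\<And>s u z. s \<le> n \<Longrightarrow> u analytic_on {z} \<Longrightarrow>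
      F s u z = (\<Sum>\<beta>\<in>betas k s. C s \<beta> * dmono s \<beta> u z)"
    by (metis atMost_iff)
  define c where "c = (\<lambda>s m \<alpha>. if 1 \<le> s \<and> s \<le> k - 1 \<and> 1 \<le> m \<and> m \<le> s \<and> \<alpha> \<in> alphas s m
                               then C s (\<alpha>(0 := k - m)) else 0)"
  have Fc: "F s u z = (\<Sum>m=1..s. u z ^ (k - m) *
                (\<Sum>\<alpha>\<in>alphas s m. c s m \<alpha> * (\<Prod>i=1..s. (deriv ^^ i) u z ^ \<alpha> i)))"
    if s: "1 \<le> s" "s \<le> n" and u: "u analytic_on {z}" for s u z
  proof -
    have "dmono s (\<alpha>(0 := x)) u z = u z ^ x * (\<Prod>i=1..s. (deriv ^^ i) u z ^ \<alpha> i)" for \<alpha> x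
    proof -
      have "{..s} = insert 0 {1..s}" by auto
      then have "dmono s (\<alpha>(0 := x)) u z = u z ^ x * (\<Prod>i=1..s. (deriv ^^ i) u z ^ (\<alpha>(0 := x)) i)"
        by (simp add: dmono_def)
      also have "(\<Prod>i=1..s. (deriv ^^ i) u z ^ (\<alpha>(0 := x)) i) = (\<Prod>i=1..s. (deriv ^^ i) u z ^ \<alpha> i)"
        by (intro prod.cong) auto
      finally show ?thesis .
    qed
    then have "F s u z = (\<Sum>m=1..s. \<Sum>\<alpha>\<in>alphas s m. C s (\<alpha>(0 := k - m)) *
                           (u z ^ (k - m) * (\<Prod>i=1..s. (deriv ^^ i) u z ^ \<alpha> i)))"
      using s u k by (simp add: C sum_betas)
    also have "\<dots> = (\<Sum>m=1..s. \<Sum>\<alpha>\<in>alphas s m. c s m \<alpha> *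
                           (u z ^ (k - m) * (\<Prod>i=1..s. (deriv ^^ i) u z ^ \<alpha> i)))"
      using s k by (intro sum.cong refl) (auto simp: c_def)
    finally show ?thesis by (simp add: sum_distrib_left mult_ac)
  qed
  have "is_expansion k c" unfolding is_expansion_def
  proof (intro conjI allI impI)
    fix u f z assume u: "u analytic_on {z}" and f: "f analytic_on {z}"
    have set: "{..n} = insert 0 {1..k - 1}" by (auto simp: k)
    have "(vf_op u ^^ k) f z = u z ^ k * (deriv ^^ k) f z + (\<Sum>s=1..k - 1. F s u z * (deriv ^^ (k - s)) f z)"
      using u f unfolding exp[OF u f] set by (simp add: F)
    also have "(\<Sum>s=1..k - 1. F s u z * (deriv ^^ (k - s)) f z) =
      (\<Sum>s=1..k - 1.
             (\<Sum>m=1..s. u z ^ (k - m) *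
                (\<Sum>\<alpha>\<in>alphas s m. c s m \<alpha> * (\<Prod>i=1..s. (deriv ^^ i) u z ^ \<alpha> i))) *
             (deriv ^^ (k - s)) f z)"
      by (intro sum.cong refl) (use u k in \<open>simp add: Fc\<close>)
    finally show "(vf_op u ^^ k) f z = u z ^ k * (deriv ^^ k) f z + \<dots>" .
  qed (auto simp: c_def)
  then show ?thesis by blast
qed

theorem is_expansion_ex1: "k \<ge> 1 \<Longrightarrow> \<exists>!c. is_expansion k c"
  using is_expansion_exists is_expansion_unique by blast

lemma is_expansion_expansion_coeff:
  assumes "k \<ge> 1"
  shows "is_expansion k (\<lambda>s m. expansion_coeff s m k)"
  using theI'[OF is_expansion_ex1[OF assms]] by (simp add: expansion_coeff_def)

end

theory Submission
  imports Defs
begin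

text \<open>For \<open>u = exp\<close> all derivatives of \<open>u\<close> are 1 at the origin, so there the coefficients of
  \<open>A\<^sup>k\<close> are precisely the sums in question. On the other hand \<open>A\<close> maps \<open>e\<^sup>\<lambda>\<^sup>z\<close> to
  \<open>\<lambda> e\<^sup>(\<^sup>\<lambda>\<^sup>+\<^sup>1\<^sup>)\<^sup>z\<close>, so that \<open>A\<^sup>k e\<^sup>\<lambda>\<^sup>z\<close> takes the value \<open>\<lambda>(\<lambda>+1)\<dots>(\<lambda>+k-1)\<close> at the origin. Put
  \<open>\<lambda> = -x\<close> and compare coefficients in \<open>x\<close>.\<close>

text \<open>Needed to move the integer coefficient into \<open>complex\<close>, where polynomials
  are compared by their values. Each new factor is linear, so a coefficient of the product involves
  at most two earlier ones.\<close>

lemma of_int_signed_stirling: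
  "(of_int (signed_stirling k s) :: 'a :: comm_ring_1) = coeff (\<Prod>i<k. [:- of_nat i, 1:]) s"
  unfolding signed_stirling_def
proof (induction k arbitrary: s)
  case 0
  show ?case by simp
next
  case (Suc k)
  show ?case
    using Suc.IH by (cases s) (simp_all add: mult.commute[of _ "[:_, 1:]"])
qed

lemma vf_op_exp_funpow:
  "(vf_op exp ^^ k) (\<lambda>z. exp (a * z)) = (\<lambda>z. (\<Prod>i<k. a + of_nat i) * exp ((a + of_nat k) * z))"
proof (induction k)
  case (Suc k)
  define C where "C = (\<Prod>i<k. a + of_nat i)"
  have "((\<lambda>z. C * exp ((a + of_nat k) * z)) has_field_derivative
      C * ((a + of_nat k) * exp ((a + of_nat k) * z))) (at z)" for z
    by (auto intro!: derivative_eq_intros)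
  then have "deriv (\<lambda>z. C * exp ((a + of_nat k) * z)) z =
      C * ((a + of_nat k) * exp ((a + of_nat k) * z))" for z
    by (rule DERIV_imp_deriv)
  moreover have "exp z * exp ((a + of_nat k) * z) = exp ((a + of_nat (Suc k)) * z)" for z
    by (simp add: exp_add[symmetric] algebra_simps)
  ultimately have "vf_op exp (\<lambda>z. C * exp ((a + of_nat k) * z)) =
      (\<lambda>z. C * (a + of_nat k) * exp ((a + of_nat (Suc k)) * z))"
    by (simp add: vf_op_def fun_eq_iff mult_ac del: of_nat_Suc)
  then show ?case
    by (simp add: Suc.IH C_def del: of_nat_Suc)
qed simp

lemma higher_deriv_exp_mult:
  "(deriv ^^ n) (\<lambda>z. exp (a * z)) = (\<lambda>z. a ^ n * exp (a * z))" for a :: complex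
proof (induction n)
  case (Suc n)
  have "((\<lambda>z. a ^ n * exp (a * z)) has_field_derivative a ^ Suc n * exp (a * z)) (at z)" for z
    by (auto intro!: derivative_eq_intros)
  then show ?case
    by (simp add: Suc.IH fun_eq_iff DERIV_imp_deriv)
qed simp

theorem corollary3p3:
  fixes k s :: nat
  assumes "k \<ge> 1" and "s \<le> k"
  shows "(if s = 0 then 1 else \<Sum>m=1..s. \<Sum>\<alpha>\<in>alphas s m. expansion_coeff s m k \<alpha>)
           = (-1) ^ s * of_int (signed_stirling k (k - s))"
proof -
  define T where "T = (\<lambda>s. if s = 0 then 1 else
    \<Sum>m=1..s. \<Sum>\<alpha>\<in>alphas s m. expansion_coeff s m k \<alpha>)"
  define P :: "complex poly" where "P = (\<Prod>i<k. [:- of_nat i, 1:])"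
  \<comment> \<open>The sign \<open>(-1) ^ r\<close> is what remains of \<open>(-1) ^ k\<close>,
    from negating the \<open>k\<close> factors of \<open>P\<close>, and
    \<open>(-1) ^ (k - r)\<close>, from the power of \<open>-x\<close>.\<close>
  define Q where "Q = (\<Sum>r\<le>k. monom ((-1) ^ r * T r) (k - r))"
  have exp: "is_expansion k (\<lambda>s m. expansion_coeff s m k)"
    using assms(1) by (rule is_expansion_expansion_coeff)
  \<comment> \<open>The index \<open>k\<close> exceeds the range \<open>s \<le> k - 1\<close>, so
    the default value 0 applies.\<close>
  then have "expansion_coeff k m k \<alpha> = 0" for m \<alpha>
    using assms(1) unfolding is_expansion_def
    by (metis One_nat_def diff_less less_le_trans not_less zero_less_one)
  then have Tk: "T k = 0"
    using assms(1) by (simp add: T_def)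
  have an: "(\<lambda>z. exp (a * z)) analytic_on S" for a :: complex and S
    by (intro analytic_intros)
  have deriv_exp: "(deriv ^^ i) exp 0 = (1 :: complex)" for i
    using higher_deriv_exp_mult[of i 1] by simp
  have "poly P x = poly Q x" for x
  proof -
    have "(\<Prod>i<k. of_nat i - x) = (vf_op exp ^^ k) (\<lambda>z. exp ((-x) * z)) 0"
      by (subst vf_op_exp_funpow) simp
    also have "\<dots> = exp 0 ^ k * (deriv ^^ k) (\<lambda>z. exp ((-x) * z)) 0 +
          (\<Sum>s=1..k - 1.
             (\<Sum>m=1..s. exp 0 ^ (k - m) *
                (\<Sum>\<alpha>\<in>alphas s m. expansion_coeff s m k \<alpha> * (\<Prod>i=1..s. (deriv ^^ i) exp 0 ^ \<alpha> i))) *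
             (deriv ^^ (k - s)) (\<lambda>z. exp ((-x) * z)) 0)"
      \<comment> \<open>\<open>an[of 1]\<close> treats \<open>u = exp\<close>,
        \<open>an[of "-x"]\<close> the function acted upon.\<close>
      using exp an[of 1] an[of "-x"] analytic_on_imp_meromorphic_on
      unfolding is_expansion_def by simp
    also have "\<dots> = T 0 * (-x) ^ k + (\<Sum>s=1..k - 1. T s * (-x) ^ (k - s))"
      unfolding higher_deriv_exp_mult deriv_exp by (simp add: T_def)
    also have "\<dots> = (\<Sum>s\<le>k. T s * (-x) ^ (k - s))"
    proof -
      \<comment> \<open>The new term \<open>s = k\<close> is harmless because
        \<open>T k = 0\<close>.\<close>
      have "{..k} = insert 0 (insert k {1..k - 1})" using assms(1) by auto
      then show ?thesis using assms(1) Tk by simp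
    qed
    finally have eq: "(\<Prod>i<k. of_nat i - x) = (\<Sum>s\<le>k. T s * (-x) ^ (k - s))" .
    have "poly P x = (\<Prod>i<k. (-1) * (of_nat i - x))"
      by (simp add: P_def poly_prod)
    also have "\<dots> = (-1) ^ k * (\<Sum>s\<le>k. T s * (-x) ^ (k - s))"
      by (simp only: prod.distrib eq) simp
    also have "\<dots> = (\<Sum>s\<le>k. (-1) ^ s * T s * x ^ (k - s))"
      unfolding sum_distrib_left
    proof (intro sum.cong refl)
      fix s assume "s \<in> {..k}"
      then have "(-1) ^ k * (-1) ^ (k - s) = ((-1) ^ s :: complex)"
        by (simp add: minus_one_power_iff)
      then show "(-1) ^ k * (T s * (-x) ^ (k - s)) = (-1) ^ s * T s * x ^ (k - s)"
        by (simp add: power_minus[of x] mult_ac)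
    qed
    also have "\<dots> = poly Q x"
      by (simp add: Q_def poly_sum poly_monom)
    finally show ?thesis .
  qed
  then have "P = Q"
    by (simp add: poly_eq_poly_eq_iff[symmetric] fun_eq_iff)
  then have "of_int (signed_stirling k (k - s)) = coeff Q (k - s)"
    by (simp add: of_int_signed_stirling P_def)
  \<comment> \<open>For \<open>r\<close> and \<open>s\<close> up to \<open>k\<close>, truncated
    subtraction gives \<open>k - r = k - s\<close> only if \<open>r = s\<close>.\<close>
  also have "\<dots> = (\<Sum>r\<le>k. if r = s then (-1) ^ s * T s else 0)"
    unfolding Q_def coeff_sum using assms(2) by (intro sum.cong) auto
  also have "\<dots> = (-1) ^ s * T s"
    using assms(2) by simp
  finally have "(-1) ^ s * of_int (signed_stirling k (k - s)) = T s"
    by (simp add: power_mult_distrib[symmetric] mult.assoc[symmetric])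
  then show ?thesis by (simp add: T_def)
qed

end
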